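(* Let $k\ge 1$ and $m\ge 1$ be integers, $n=2k+1$, $N=n+m$. For every $\varepsilon\in(0,1)$ there is $\delta>0$ such that, in the region $\{(a,b)\in\mathbb{R}^2 : 0\le a<\delta,\ 0\le b<\delta\}$, the partial derivative $\frac{\partial V(a,b)}{\partial b}$ is equal to a polynomial of degree $k-1$ in the variables $a^2$ and $b^2$, where $V(a,b)$ is the larger of the volumes of the two parts into which the hyperplane $x_1=ay_1+b$ in $\mathbb{R}^N$ cuts the body $$W=\left\{(x,y)\in\mathbb{R}^n\times\mathbb{R}^m : (x_1^2+\dots+x_n^2-1)^2+(y_1^2+\dots+y_m^2)\le \varepsilon^2\right\}.$$
   Context: The coordinates $x_1,\dots,x_n$ and $y_1,\dots,y_m$ are the standard coordinates in the Euclidean spaces $\mathbb{R}^n$ and $\mathbb{R}^m$, and $\mathbb{R}^N=\mathbb{R}^n\times\mathbb{R}^m$. The body $W$ (depending on $\varepsilon$) is a compact neighborhood of the sphere $\{x_1^2+\dots+x_n^2=1,\ y=0\}$. For $a\ge 0$, $b\ge 0$, $L(a,b)$ denotes the hyperplane $\{x_1=ay_1+b\}\subset\mathbb{R}^N$; the two parts into which it cuts $W$ are the intersections of $W$ with the two half-spaces bounded by $L(a,b)$. For $b>0$ the larger of the two volumes is that of the part of $W$ lying in the half-space that contains the origin; for $b=0$ the two volumes are equal. At $b=0$ the derivative in $b$ is the one-sided derivative. The number $\delta$ and the coefficients of the polynomial may depend on $\varepsilon$, $k$ and $m$. *)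

theory Defs
  imports "HOL-Analysis.Analysis"
begin

definition W_body :: "real \<Rightarrow> ((real ^ 'n::finite) \<times> (real ^ 'm::finite)) set" where
  "W_body \<epsilon> =
    {(x, y). ((\<Sum>l\<in>UNIV. (x $ l)\<^sup>2) - 1)\<^sup>2 + (\<Sum>l\<in>UNIV. (y $ l)\<^sup>2) \<le> \<epsilon>\<^sup>2}"

text \<open>
  The indices \<open>i\<close> and \<open>j\<close> select the coordinates written \<open>x\<^sub>1\<close> and \<open>y\<^sub>1\<close>; the finite index types
  carry no order, so an arbitrary index plays the role of the first one. The two parts are closed
  and share their section by the hyperplane, which is a null set. Since the body is compact, the
  real-valued \<^const>\<open>measure\<close> is its actual (finite) volume.
\<close>

definition lower_part :: "'n::finite \<Rightarrow> 'm::finite \<Rightarrow> real \<Rightarrow> real \<Rightarrow> real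
    \<Rightarrow> ((real ^ 'n) \<times> (real ^ 'm)) set" where
  "lower_part i j \<epsilon> a b = W_body \<epsilon> \<inter> {(x, y). x $ i \<le> a * y $ j + b}"

definition upper_part :: "'n::finite \<Rightarrow> 'm::finite \<Rightarrow> real \<Rightarrow> real \<Rightarrow> real
    \<Rightarrow> ((real ^ 'n) \<times> (real ^ 'm)) set" where
  "upper_part i j \<epsilon> a b = W_body \<epsilon> \<inter> {(x, y). x $ i \<ge> a * y $ j + b}"

definition larger_volume :: "'n::finite \<Rightarrow> 'm::finite \<Rightarrow> real \<Rightarrow> real \<Rightarrow> real \<Rightarrow> real" where
  "larger_volume i j \<epsilon> a b =
    max (measure lebesgue (lower_part i j \<epsilon> a b)) (measure lebesgue (upper_part i j \<epsilon> a b))"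

text \<open>
  Real polynomial functions of two variables whose total degree is exactly \<open>d\<close>.
\<close>

definition bivariate_polynomial_of_degree :: "nat \<Rightarrow> (real \<Rightarrow> real \<Rightarrow> real) \<Rightarrow> bool" where
  "bivariate_polynomial_of_degree d p \<longleftrightarrow>
    (\<exists>c :: nat \<Rightarrow> nat \<Rightarrow> real.
      (\<forall>u v. p u v = (\<Sum>(r, s) \<in> {(r, s). r + s \<le> d}. c r s * u ^ r * v ^ s)) \<and>
      (\<exists>r s. r + s = d \<and> c r s \<noteq> 0))"

end

theory Submission
  imports Defs
begin

text \<open>
  By Fubini, the derivative of the volume in \<open>b\<close> is the integral over \<open>\<bar>y\<bar> \<le> \<epsilon>\<close> of the volume of
  the slice \<open>{x. (x, y) \<in> W, x\<^sub>1 = a y\<^sub>1 + b}\<close>. With \<open>\<sigma> = sqrt (\<epsilon>\<^sup>2 - \<bar>y\<bar>\<^sup>2)\<close> and \<open>u = a y\<^sub>1 + b\<close>, this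
  slice is the shell \<open>1 - \<sigma> - u\<^sup>2 \<le> \<bar>x'\<bar>\<^sup>2 \<le> 1 + \<sigma> - u\<^sup>2\<close> in dimension \<open>2k\<close>. For \<open>u\<^sup>2 < 1 - \<epsilon>\<close> both radii
  are real, and because the dimension is even, the volume is a constant times
  \<open>(1 + \<sigma> - u\<^sup>2)\<^sup>k - (1 - \<sigma> - u\<^sup>2)\<^sup>k\<close>, a polynomial of degree \<open>k - 1\<close> in \<open>u\<^sup>2\<close> with leading coefficient
  proportional to \<open>\<sigma>\<close>. The odd powers of \<open>y\<^sub>1\<close> integrate to zero, which leaves only even powers of
  \<open>a\<close> and \<open>b\<close>, and the coefficient of \<open>b\<^bsup>2(k-1)\<^esup>\<close> is a nonzero multiple of \<open>\<integral>\<sigma>\<close>.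
\<close>

section \<open>Volumes of shells and of their slabs\<close>

text \<open>With the inner sphere left out, the shell is exactly a difference of two closed balls.
  In even dimension \<open>sqrt t ^ (2 * k)\<close> is \<open>t ^ k\<close>, so the volume is
  polynomial in the squared radii.\<close>

lemma emeasure_PiM_shell:
  fixes A :: "'i set"
  assumes A: "finite A" "card A = 2 * k" and r: "0 < r" "r \<le> s"
  shows "emeasure (Pi\<^sub>M A (\<lambda>_. lborel))
      ({f. r < (\<Sum>i\<in>A. (f i)\<^sup>2) \<and> (\<Sum>i\<in>A. (f i)\<^sup>2) \<le> s} \<inter> space (Pi\<^sub>M A (\<lambda>_. lborel)))
    = ennreal (unit_ball_vol (2 * k) * (s ^ k - r ^ k))"
proof -
  let ?M = "Pi\<^sub>M A (\<lambda>_. lborel :: real measure)"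
  define B where "B t = {f. sqrt (\<Sum>i\<in>A. (f i)\<^sup>2) \<le> sqrt t} \<inter> space ?M" for t
  have vol: "emeasure ?M (B t) = ennreal (unit_ball_vol (2 * k) * t ^ k)" if "0 < t" for t
    using emeasure_cball_aux[of A "sqrt t"] A that by (simp add: B_def power_mult)
  have sets: "B t \<in> sets ?M" for t
    unfolding B_def by measurable
  have "{f. r < (\<Sum>i\<in>A. (f i)\<^sup>2) \<and> (\<Sum>i\<in>A. (f i)\<^sup>2) \<le> s} \<inter> space ?M = B s - B r"
    by (auto simp: B_def)
  also have "emeasure ?M (B s - B r) = emeasure ?M (B s) - emeasure ?M (B r)"
  proof (intro emeasure_Diff sets)
    show "emeasure ?M (B r) \<noteq> \<infinity>"
      using r by (simp add: vol)
    show "B r \<subseteq> B s"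
      using r by (auto simp: B_def)
  qed
  also have "\<dots> = ennreal (unit_ball_vol (2 * k) * (s ^ k - r ^ k))"
    using r by (simp add: vol ennreal_minus right_diff_distrib del: of_nat_mult)
  finally show ?thesis .
qed

text \<open>Fubini with the coordinate along \<open>b\<close> outermost: the section at height
  \<open>u\<close> is a shell in the other \<open>2 * k\<close> coordinates, with squared radii
  \<open>r - u^2\<close> and \<open>s - u^2\<close>. The bound \<open>u^2 < r\<close> on
  \<open>T\<close> keeps the inner one positive, so a single formula holds on all of
  \<open>T\<close>.\<close>

lemma emeasure_shell_slab:
  fixes b :: "'a :: euclidean_space"
  assumes b: "b \<in> Basis" and dim: "DIM('a) = 2 * k + 1"
    and T: "T \<in> sets borel" "\<And>u. u \<in> T \<Longrightarrow> u\<^sup>2 < r" and "r \<le> s"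
  shows "emeasure lborel {x :: 'a. x \<bullet> b \<in> T \<and> r \<le> (norm x)\<^sup>2 \<and> (norm x)\<^sup>2 \<le> s}
    = (\<integral>\<^sup>+u. ennreal (unit_ball_vol (2 * k) * ((s - u\<^sup>2) ^ k - (r - u\<^sup>2) ^ k)) * indicator T u \<partial>lborel)"
proof -
  interpret product_sigma_finite "\<lambda>_::'a. lborel :: real measure"
    by standard
  let ?A = "Basis - {b} :: 'a set"
  let ?M = "Pi\<^sub>M Basis (\<lambda>_::'a. lborel :: real measure)"
  let ?N = "Pi\<^sub>M ?A (\<lambda>_. lborel :: real measure)"
  let ?h = "\<lambda>f. \<Sum>b\<in>Basis. f b *\<^sub>R b :: 'a"
  note [measurable] = T(1)
  define X where "X = {x :: 'a. x \<bullet> b \<in> T \<and> r < (norm x)\<^sup>2 \<and> (norm x)\<^sup>2 \<le> s}"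
  define Y where "Y = {f. f b \<in> T \<and> r < (\<Sum>c\<in>Basis. (f c)\<^sup>2) \<and> (\<Sum>c\<in>Basis. (f c)\<^sup>2) \<le> s} \<inter> space ?M"
  have [measurable]: "X \<in> sets borel"
    unfolding X_def by measurable
  have [measurable]: "Y \<in> sets ?M"
    using b unfolding Y_def by measurable
  have nrm: "(norm (?h f))\<^sup>2 = (\<Sum>c\<in>Basis. (f c)\<^sup>2)" for f
    by (simp add: norm_eq_sqrt_inner euclidean_inner[of "?h f" "?h f"] sum_nonneg power2_eq_square)
  have "sphere 0 (sqrt r) \<in> null_sets (lborel :: 'a measure)"
    using negligible_sphere[of "0::'a" "sqrt r"]
    by (auto simp: null_sets_completion_iff negligible_iff_null_sets)
  \<comment> \<open>Dropping the inner sphere turns the shell into a difference of two closed balls.\<close>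
  hence null: "{x :: 'a. x \<bullet> b \<in> T \<and> (norm x)\<^sup>2 = r \<and> r \<le> s} \<in> null_sets lborel"
    by (rule null_sets_subset) (auto simp: real_sqrt_unique[symmetric])
  have "{x :: 'a. x \<bullet> b \<in> T \<and> r \<le> (norm x)\<^sup>2 \<and> (norm x)\<^sup>2 \<le> s}
      = X \<union> {x. x \<bullet> b \<in> T \<and> (norm x)\<^sup>2 = r \<and> r \<le> s}"
    by (auto simp: X_def)
  hence "emeasure lborel {x :: 'a. x \<bullet> b \<in> T \<and> r \<le> (norm x)\<^sup>2 \<and> (norm x)\<^sup>2 \<le> s} = emeasure lborel X"
    using null by (simp add: emeasure_Un_null_set)
  also have "\<dots> = emeasure (distr ?M borel ?h) X"
    by (subst lborel_eq) simp
  also have "\<dots> = emeasure ?M Y"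
    using b by (subst emeasure_distr) (auto simp: X_def Y_def nrm intro!: arg_cong[where f = "emeasure ?M"])
  \<comment> \<open>Writing the index set as \<open>insert b ?A\<close> allows the coordinate
    \<open>b\<close> to be split off as the outer integral.\<close>
  also have "\<dots> = (\<integral>\<^sup>+f. indicator Y f \<partial>Pi\<^sub>M (insert b ?A) (\<lambda>_. lborel))"
    using b by (simp add: insert_absorb)
  also have "\<dots> = (\<integral>\<^sup>+u. \<integral>\<^sup>+f. indicator Y (f(b := u)) \<partial>?N \<partial>lborel)"
    using b by (subst product_nn_integral_insert_rev) (auto simp: insert_absorb)
  also have "\<dots> = (\<integral>\<^sup>+u. ennreal (unit_ball_vol (2 * k) * ((s - u\<^sup>2) ^ k - (r - u\<^sup>2) ^ k))
      * indicator T u \<partial>lborel)"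
  proof (rule nn_integral_cong)
    fix u :: real
    let ?Z = "{f. r - u\<^sup>2 < (\<Sum>c\<in>?A. (f c)\<^sup>2) \<and> (\<Sum>c\<in>?A. (f c)\<^sup>2) \<le> s - u\<^sup>2} \<inter> space ?N"
    have sum: "(\<Sum>c\<in>Basis. (if c = b then u else f c)\<^sup>2) = u\<^sup>2 + (\<Sum>c\<in>?A. (f c)\<^sup>2)" for f
      using b by (subst sum.remove[of _ b]) auto
    have "(\<integral>\<^sup>+f. indicator Y (f(b := u)) \<partial>?N) = (\<integral>\<^sup>+f. indicator T u * indicator ?Z f \<partial>?N)"
    proof (rule nn_integral_cong)
      fix f assume f: "f \<in> space ?N"
      have "f(b := u) \<in> space ?M"
        using f b by (auto simp: space_PiM PiE_def extensional_def)
      thus "indicator Y (f(b := u)) = (indicator T u * indicator ?Z f :: ennreal)"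
        using f by (auto simp: Y_def indicator_def sum)
    qed
    also have "\<dots> = indicator T u * emeasure ?N ?Z"
      by (simp add: nn_integral_cmult)
    also have "\<dots> = ennreal (unit_ball_vol (2 * k) * ((s - u\<^sup>2) ^ k - (r - u\<^sup>2) ^ k)) * indicator T u"
    proof (cases "u \<in> T")
      case True
      thus ?thesis
        using emeasure_PiM_shell[of ?A k "r - u\<^sup>2" "s - u\<^sup>2"] T(2)[of u] b dim \<open>r \<le> s\<close>
        by (simp add: card_Diff_singleton)
    qed simp
    finally show "(\<integral>\<^sup>+f. indicator Y (f(b := u)) \<partial>?N) = \<dots>" .
  qed
  finally show ?thesis .
qed

section \<open>Polynomial expansion of the section volume and integration over the y-ball\<close>

text \<open>Both powers are expanded in \<open>- w\<close>. At \<open>e = k\<close> the bracket is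
  \<open>1 - 1 = 0\<close>, so the sum stops below \<open>k\<close>; this is where the degree drops
  to \<open>k - 1\<close>.\<close>

lemma power_diff_shifted:
  fixes s w :: "'a :: comm_ring_1"
  shows "(1 + s - w) ^ k - (1 - s - w) ^ k
    = (\<Sum>e<k. of_nat (k choose e) * (- 1) ^ e * ((1 + s) ^ (k - e) - (1 - s) ^ (k - e)) * w ^ e)"
proof -
  have bin: "(z - w) ^ k = (\<Sum>e\<le>k. of_nat (k choose e) * (- 1) ^ e * z ^ (k - e) * w ^ e)" for z
    using binomial_ring[of "- w" z k] by (simp add: mult_ac power_minus[of w])
  have "(1 + s - w) ^ k - (1 - s - w) ^ k
      = (\<Sum>e\<le>k. of_nat (k choose e) * (- 1) ^ e * ((1 + s) ^ (k - e) - (1 - s) ^ (k - e)) * w ^ e)"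
    unfolding bin sum_subtractf[symmetric] by (intro sum.cong) (simp_all add: algebra_simps)
  thus ?thesis
    by (simp add: lessThan_Suc_atMost[symmetric])
qed

lemma sum_even_indices:
  fixes f :: "nat \<Rightarrow> 'a :: comm_monoid_add"
  assumes "\<And>l. odd l \<Longrightarrow> f l = 0"
  shows "(\<Sum>l\<le>2 * e. f l) = (\<Sum>r\<le>e. f (2 * r))"
  using assms by (induction e) auto

lemma set_integrable_compact:
  fixes f :: "'a :: euclidean_space \<Rightarrow> 'b :: {banach, second_countable_topology}"
  assumes "compact S" "continuous_on S f"
  shows "set_integrable lborel S f"
  unfolding set_integrable_def by (rule borel_integrable_compact[OF assms])

lemma set_integral_sum:
  fixes f :: "'i \<Rightarrow> 'a \<Rightarrow> 'b :: {banach, second_countable_topology}"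
  assumes "\<And>i. i \<in> I \<Longrightarrow> set_integrable M A (f i)"
  shows "(LINT x:A|M. (\<Sum>i\<in>I. f i x)) = (\<Sum>i\<in>I. LINT x:A|M. f i x)"
  using assms unfolding set_lebesgue_integral_def set_integrable_def
  by (simp add: scaleR_sum_right Bochner_Integration.integral_sum)

lemma distr_uminus_lborel: "distr lborel borel uminus = (lborel :: 'a :: euclidean_space measure)"
  using lborel_affine[of "- 1" "0 :: 'a"] by (simp add: density_1)

text \<open>The reflection through the origin preserves Lebesgue measure and the centred ball, so
  the integral equals its own negative.\<close>

lemma set_integral_cball_odd:
  fixes f :: "'a :: euclidean_space \<Rightarrow> real"
  assumes [measurable]: "f \<in> borel_measurable borel" and odd: "\<And>y. f (- y) = - f y"
  shows "(LINT y:cball 0 \<epsilon>|lborel. f y) = 0"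
proof -
  have [measurable]: "cball (0 :: 'a) \<epsilon> \<in> sets borel"
    by simp
  have "(LINT y:cball 0 \<epsilon>|lborel. f y) = (LINT y:cball 0 \<epsilon>|distr lborel borel uminus. f y)"
    by (simp add: distr_uminus_lborel)
  also have "\<dots> = (LINT y|lborel. indicator (cball 0 \<epsilon>) (- y) *\<^sub>R f (- y))"
    unfolding set_lebesgue_integral_def by (subst integral_distr) simp_all
  also have "\<dots> = - (LINT y:cball 0 \<epsilon>|lborel. f y)"
    unfolding set_lebesgue_integral_def by (simp add: odd indicator_def)
  finally show ?thesis
    by simp
qed

text \<open>The coefficient of \<open>w\<^sup>e\<close> in \<open>(1 + s - w)\<^sup>k - (1 - s - w)\<^sup>k\<close> for \<open>e < k\<close>.\<close>

definition shell_coeff :: "nat \<Rightarrow> nat \<Rightarrow> real \<Rightarrow> real" where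
  "shell_coeff k e s = real (k choose e) * (- 1) ^ e * ((1 + s) ^ (k - e) - (1 - s) ^ (k - e))"

lemma continuous_shell_coeff [continuous_intros]:
  "continuous_on S f \<Longrightarrow> continuous_on S (\<lambda>x. shell_coeff k e (f x))"
  unfolding shell_coeff_def by (intro continuous_intros)

text \<open>Two binomial expansions, first in the square
  \<open>w = (a * (y \<bullet> b) + v)^2\<close> and then of \<open>w ^ e\<close>, yield the
  monomials \<open>a ^ l * v ^ (2 * e - l)\<close>. Since \<open>\<sigma>\<close> is even, the
  integrands with odd \<open>l\<close> are odd and drop out. Setting \<open>l = 2 * r\<close> and
  \<open>q = e - r\<close> leaves powers of the squares of \<open>a\<close> and
  \<open>v\<close>.\<close>

lemma integral_shell_polynomial:
  fixes b :: "'a :: euclidean_space" and \<sigma> :: "'a \<Rightarrow> real"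
  assumes k: "k \<ge> 1" and \<sigma>: "continuous_on UNIV \<sigma>" "\<And>y. \<sigma> (- y) = \<sigma> y"
  shows "(LINT y:cball 0 \<epsilon>|lborel.
        (1 + \<sigma> y - (a * (y \<bullet> b) + v)\<^sup>2) ^ k - (1 - \<sigma> y - (a * (y \<bullet> b) + v)\<^sup>2) ^ k)
    = (\<Sum>(r, q)\<in>{(r, q). r + q \<le> k - 1}. real (2 * (r + q) choose (2 * r))
        * (LINT y:cball 0 \<epsilon>|lborel. (y \<bullet> b) ^ (2 * r) * shell_coeff k (r + q) (\<sigma> y))
        * (a\<^sup>2) ^ r * (v\<^sup>2) ^ q)"
proof -
  define M where "M e l = (LINT y:cball 0 \<epsilon>|lborel. (y \<bullet> b) ^ l * shell_coeff k e (\<sigma> y))" for e l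
  define G where "G e l y =
      (real (2 * e choose l) * a ^ l * v ^ (2 * e - l)) * ((y \<bullet> b) ^ l * shell_coeff k e (\<sigma> y))"
    for e l y
  have cont: "continuous_on S (\<lambda>y. (y \<bullet> b) ^ l * shell_coeff k e (\<sigma> y))" for S e l
    by (intro continuous_intros continuous_on_subset[OF \<sigma>(1)]) auto
  have int: "set_integrable lborel (cball 0 \<epsilon>) (\<lambda>y. (y \<bullet> b) ^ l * shell_coeff k e (\<sigma> y))" for e l
    by (intro set_integrable_compact cont compact_cball)
  have M_odd: "M e l = 0" if "odd l" for e l
    unfolding M_def
    by (rule set_integral_cball_odd) (use that \<sigma>(2) cont in \<open>auto intro: borel_measurable_continuous_onI\<close>)
  have G_int: "set_integrable lborel (cball 0 \<epsilon>) (G e l)" for e l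
    unfolding G_def by (intro set_integrable_mult_right int)
  have G_sum_int: "set_integrable lborel (cball 0 \<epsilon>) (\<lambda>y. \<Sum>l\<in>L. G e l y)" for e L
    using G_int unfolding set_integrable_def scaleR_sum_right by (intro Bochner_Integration.integrable_sum)
  have G_integral: "(LINT y:cball 0 \<epsilon>|lborel. G e l y) = real (2 * e choose l) * a ^ l * v ^ (2 * e - l) * M e l" for e l
    unfolding G_def M_def by simp
  have expand: "(1 + \<sigma> y - (a * (y \<bullet> b) + v)\<^sup>2) ^ k - (1 - \<sigma> y - (a * (y \<bullet> b) + v)\<^sup>2) ^ k
      = (\<Sum>e<k. \<Sum>l\<le>2 * e. G e l y)" for y
  proof -
    have "((a * (y \<bullet> b) + v)\<^sup>2) ^ e = (\<Sum>l\<le>2 * e. real (2 * e choose l) * (a * (y \<bullet> b)) ^ l * v ^ (2 * e - l))" for e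
      unfolding power_mult[symmetric] by (rule binomial_ring)
    thus ?thesis
      unfolding power_diff_shifted
      by (simp add: G_def shell_coeff_def sum_distrib_left power_mult_distrib mult_ac)
  qed
  have "(LINT y:cball 0 \<epsilon>|lborel.
        (1 + \<sigma> y - (a * (y \<bullet> b) + v)\<^sup>2) ^ k - (1 - \<sigma> y - (a * (y \<bullet> b) + v)\<^sup>2) ^ k)
      = (\<Sum>e<k. \<Sum>l\<le>2 * e. real (2 * e choose l) * a ^ l * v ^ (2 * e - l) * M e l)"
    unfolding expand by (simp add: set_integral_sum G_sum_int G_int G_integral)
  also have "\<dots> = (\<Sum>e<k. \<Sum>r\<le>e. real (2 * e choose (2 * r)) * a ^ (2 * r) * v ^ (2 * e - 2 * r) * M e (2 * r))"
    by (intro sum.cong refl sum_even_indices) (simp add: M_odd)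
  also have "{..<k} = {..k - 1}"
    using k by auto
  \<comment> \<open>Each \<open>e\<close> is rewritten as \<open>r + (e - r)\<close>, so that the
    summand depends only on \<open>r\<close> and \<open>q = e - r\<close>, as the triangular
    reindexing requires.\<close>
  also have "(\<Sum>e\<le>k - 1. \<Sum>r\<le>e. real (2 * e choose (2 * r)) * a ^ (2 * r) * v ^ (2 * e - 2 * r) * M e (2 * r))
      = (\<Sum>e\<le>k - 1. \<Sum>r\<le>e. real (2 * (r + (e - r)) choose (2 * r)) * M (r + (e - r)) (2 * r)
          * (a\<^sup>2) ^ r * (v\<^sup>2) ^ (e - r))"
    by (intro sum.cong refl) (simp add: power_mult diff_mult_distrib2[symmetric])
  also have "\<dots> = (\<Sum>(r, q)\<in>{(r, q). r + q \<le> k - 1}.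
      real (2 * (r + q) choose (2 * r)) * M (r + q) (2 * r) * (a\<^sup>2) ^ r * (v\<^sup>2) ^ q)"
    by (rule sum.triangle_reindex_eq[symmetric])
  finally show ?thesis
    unfolding M_def .
qed

lemma integral_cball_sqrt_pos:
  assumes "0 < \<epsilon>"
  shows "(LINT y:cball (0 :: 'a :: euclidean_space) \<epsilon>|lborel. sqrt (\<epsilon>\<^sup>2 - (norm y)\<^sup>2)) > 0"
proof -
  \<comment> \<open>The value of the integrand on the sphere of radius
    \<open>\<epsilon> / 2\<close>, hence a positive lower bound on the ball of that radius; on the
    rest of the large ball the integrand is nonnegative.\<close>
  define d where "d = sqrt (\<epsilon>\<^sup>2 - (\<epsilon> / 2)\<^sup>2)"
  have d: "d > 0"
    using assms by (simp add: d_def power2_eq_square field_simps)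
  have "0 < d * measure lborel (cball (0 :: 'a) (\<epsilon> / 2))"
    using assms d by (simp add: content_cball)
  also have "\<dots> = (LINT y|lborel. indicator (cball (0 :: 'a) (\<epsilon> / 2)) y *\<^sub>R d)"
    by simp
  also have "\<dots> \<le> (LINT y:cball (0 :: 'a) \<epsilon>|lborel. sqrt (\<epsilon>\<^sup>2 - (norm y)\<^sup>2))"
    unfolding set_lebesgue_integral_def
  proof (intro integral_mono borel_integrable_compact compact_cball continuous_intros)
    show "indicator (cball 0 (\<epsilon> / 2)) y *\<^sub>R d \<le> indicator (cball 0 \<epsilon>) y *\<^sub>R sqrt (\<epsilon>\<^sup>2 - (norm y)\<^sup>2)" for y :: 'a
      using assms power_mono[of "norm y" "\<epsilon> / 2" 2] power_mono[of "norm y" \<epsilon> 2]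
      by (auto simp: indicator_def d_def)
  qed
  finally show ?thesis .
qed

section \<open>The body: measurability, boundedness and central symmetry\<close>

lemma W_body_eq:
  "W_body \<epsilon> = {(x, y). ((norm x)\<^sup>2 - 1)\<^sup>2 + (norm y)\<^sup>2 \<le> \<epsilon>\<^sup>2}"
  by (simp add: W_body_def norm_vec_def L2_set_def sum_nonneg)

lemma W_body_Int_sets:
  fixes i :: "'n::finite" and j :: "'m::finite"
  assumes [measurable]: "T \<in> sets borel"
  shows "W_body \<epsilon> \<inter> {(x :: real ^ 'n, y :: real ^ 'm). x $ i - a * (y $ j) \<in> T} \<in> sets borel"
proof -
  have [measurable]: "(\<lambda>p :: (real ^ 'n) \<times> (real ^ 'm). fst p $ i - a * (snd p $ j)) \<in> borel_measurable borel"
    "(\<lambda>p :: (real ^ 'n) \<times> (real ^ 'm). ((norm (fst p))\<^sup>2 - 1)\<^sup>2 + (norm (snd p))\<^sup>2) \<in> borel_measurable borel"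
    by (intro borel_measurable_continuous_onI continuous_intros)+
  have "W_body \<epsilon> \<inter> {(x :: real ^ 'n, y :: real ^ 'm). x $ i - a * (y $ j) \<in> T}
      = {p \<in> space borel. ((norm (fst p))\<^sup>2 - 1)\<^sup>2 + (norm (snd p))\<^sup>2 \<le> \<epsilon>\<^sup>2
          \<and> fst p $ i - a * (snd p $ j) \<in> T}"
    by (auto simp: W_body_eq)
  also have "\<dots> \<in> sets borel"
    by measurable
  finally show ?thesis .
qed

lemma bounded_W_body: "bounded (W_body \<epsilon> :: ((real ^ 'n) \<times> (real ^ 'm)) set)" (is "bounded ?W")
proof (rule bounded_subset)
  show "?W \<subseteq> cball 0 (2 + \<bar>\<epsilon>\<bar>) \<times> cball 0 \<bar>\<epsilon>\<bar>"
  proof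
    fix p :: "(real ^ 'n) \<times> (real ^ 'm)"
    assume "p \<in> ?W"
    then obtain x y where p: "p = (x, y)" and le: "((norm x)\<^sup>2 - 1)\<^sup>2 + (norm y)\<^sup>2 \<le> \<epsilon>\<^sup>2"
      by (auto simp: W_body_eq)
    have y: "(norm y)\<^sup>2 \<le> \<epsilon>\<^sup>2" and x: "((norm x)\<^sup>2 - 1)\<^sup>2 \<le> \<epsilon>\<^sup>2"
      using le zero_le_power2[of "(norm x)\<^sup>2 - 1"] zero_le_power2[of "norm y"] by linarith+
    have "(norm x)\<^sup>2 \<le> 1 + \<bar>\<epsilon>\<bar>"
      using x by (auto simp: abs_le_square_iff[symmetric])
    \<comment> \<open>This turns the bound on the squared norm into a bound on the norm without
      taking roots.\<close>
    moreover have "2 * norm x \<le> (norm x)\<^sup>2 + 1"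
      using zero_le_power2[of "norm x - 1"] by (simp add: power2_diff)
    moreover have "norm y \<le> \<bar>\<epsilon>\<bar>"
      using y by (simp add: abs_le_square_iff[symmetric])
    ultimately show "p \<in> cball 0 (2 + \<bar>\<epsilon>\<bar>) \<times> cball 0 \<bar>\<epsilon>\<bar>"
      by (simp add: p)
  qed
qed (intro bounded_Times bounded_cball)

lemma lower_part_eq: "lower_part i j \<epsilon> a t = W_body \<epsilon> \<inter> {(x, y). x $ i - a * (y $ j) \<in> {..t}}"
  by (auto simp: lower_part_def)

lemma upper_part_eq: "upper_part i j \<epsilon> a t = W_body \<epsilon> \<inter> {(x, y). x $ i - a * (y $ j) \<in> {t..}}"
  by (auto simp: upper_part_def)

text \<open>The body is symmetric about the origin, and the reflection carries the upper part at
  \<open>t\<close> to the lower part at \<open>- t\<close>, which is contained in the lower part at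
  \<open>t\<close> because \<open>- t \<le> t\<close>.\<close>

lemma larger_volume_eq_lower:
  assumes "t \<ge> 0"
  shows "larger_volume i j \<epsilon> a t = measure lborel (lower_part i j \<epsilon> a t)"
proof -
  have sets: "lower_part i j \<epsilon> a u \<in> sets borel" "upper_part i j \<epsilon> a u \<in> sets borel" for u
    unfolding lower_part_eq upper_part_eq by (intro W_body_Int_sets; simp)+
  have "measure lborel (upper_part i j \<epsilon> a t) = measure (distr lborel borel uminus) (upper_part i j \<epsilon> a t)"
    by (simp add: distr_uminus_lborel)
  also have "\<dots> = measure lborel (uminus -` upper_part i j \<epsilon> a t)"
    using sets by (simp add: measure_distr)
  also have "uminus -` upper_part i j \<epsilon> a t = lower_part i j \<epsilon> a (- t)"
    by (auto simp: lower_part_def upper_part_def W_body_def)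
  also have "measure lborel (lower_part i j \<epsilon> a (- t)) \<le> measure lborel (lower_part i j \<epsilon> a t)"
  proof (rule measure_mono_fmeasurable)
    show "lower_part i j \<epsilon> a t \<in> fmeasurable lborel"
      using sets emeasure_bounded_finite[OF bounded_subset[OF bounded_W_body], of "lower_part i j \<epsilon> a t" \<epsilon>]
      by (auto simp: fmeasurable_def lower_part_def)
    show "lower_part i j \<epsilon> a (- t) \<in> sets lborel"
      using sets by simp
  qed (use assms in \<open>auto simp: lower_part_def\<close>)
  finally show ?thesis
    using sets by (simp add: larger_volume_def)
qed

section \<open>The volume as an integral over parallel hyperplane sections\<close>

text \<open>Fubini is applied twice: slices at fixed \<open>y\<close> are slabs of shells, and the
  order of \<open>y\<close> and \<open>v = x $ i - a * (y $ j)\<close> is then exchanged. A general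
  \<open>T\<close> serves both the half-open interval whose slab is measured and the closed interval
  on which \<open>P\<close> must be nonnegative.\<close>

lemma emeasure_W_body_slab:
  fixes i :: "'n::finite" and j :: "'m::finite" and T :: "real set"
  assumes k: "CARD('n) = 2 * k + 1" and \<epsilon>: "0 < \<epsilon>" "\<epsilon> < 1"
    and T: "T \<in> sets borel" "\<And>v. v \<in> T \<Longrightarrow> \<bar>v\<bar> \<le> sqrt (1 - \<epsilon>) / 2"
    and a: "\<bar>a\<bar> \<le> sqrt (1 - \<epsilon>) / 2"
  defines "\<sigma> \<equiv> \<lambda>y :: real ^ 'm. sqrt (\<epsilon>\<^sup>2 - (norm y)\<^sup>2)"
  defines "P \<equiv> \<lambda>v. LINT y:cball 0 \<epsilon>|lborel.
    (1 + \<sigma> y - (a * (y $ j) + v)\<^sup>2) ^ k - (1 - \<sigma> y - (a * (y $ j) + v)\<^sup>2) ^ k"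
  shows "emeasure lborel (W_body \<epsilon> \<inter> {(x :: real ^ 'n, y :: real ^ 'm). x $ i - a * (y $ j) \<in> T})
      = (\<integral>\<^sup>+v. ennreal (unit_ball_vol (2 * k) * P v) * indicator T v \<partial>lborel)"
    and "v \<in> T \<Longrightarrow> 0 \<le> P v"
proof -
  define Q where "Q y u = (1 + \<sigma> y - u\<^sup>2) ^ k - (1 - \<sigma> y - u\<^sup>2) ^ k" for y u
  let ?S = "W_body \<epsilon> \<inter> {(x :: real ^ 'n, y :: real ^ 'm). x $ i - a * (y $ j) \<in> T}"
  note [measurable] = T(1)
  have [measurable]: "cball (0 :: real ^ 'm) \<epsilon> \<in> sets borel"
    by simp
  \<comment> \<open>Outside the ball the radicand is negative, but \<open>sqrt\<close> is extended
    as an odd function and is continuous on the whole real line.\<close>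
  have \<sigma>_cont: "continuous_on S \<sigma>" for S
    unfolding \<sigma>_def by (intro continuous_intros)
  have [measurable]: "(\<lambda>y :: real ^ 'm. y $ j) \<in> borel_measurable borel"
    by (intro borel_measurable_continuous_onI continuous_intros)
  have [measurable]: "\<sigma> \<in> borel_measurable borel"
    by (intro borel_measurable_continuous_onI \<sigma>_cont)
  have S: "?S \<in> sets borel"
    using T(1) by (rule W_body_Int_sets)
  have \<sigma>_le: "0 \<le> \<sigma> y" "\<sigma> y \<le> \<epsilon>" if "norm y \<le> \<epsilon>" for y
  proof -
    have "(norm y)\<^sup>2 \<le> \<epsilon>\<^sup>2"
      using that by (intro power_mono) auto
    thus "0 \<le> \<sigma> y" "\<sigma> y \<le> \<epsilon>"
      using \<epsilon> by (auto simp: \<sigma>_def intro!: real_le_lsqrt)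
  qed
  \<comment> \<open>The two summands contribute at most half of \<open>sqrt (1 - \<epsilon>)\<close>
    each, the first strictly less because \<open>\<epsilon> < 1\<close>. As
    \<open>\<sigma> y \<le> \<epsilon>\<close>, the inner squared radius of every section is
    positive.\<close>
  have small: "(a * (y $ j) + v)\<^sup>2 < 1 - \<sigma> y" if "norm y \<le> \<epsilon>" "v \<in> T" for y v
  proof -
    have "\<bar>a * (y $ j)\<bar> \<le> sqrt (1 - \<epsilon>) / 2 * \<epsilon>"
      unfolding abs_mult using a \<epsilon> that component_le_norm_cart[of y j] by (intro mult_mono) auto
    also have "\<dots> < sqrt (1 - \<epsilon>) / 2"
      using \<epsilon> by simp
    finally have "\<bar>a * (y $ j) + v\<bar> < sqrt (1 - \<epsilon>)"
      using T(2)[OF that(2)] by linarith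
    hence "\<bar>a * (y $ j) + v\<bar>\<^sup>2 < (sqrt (1 - \<epsilon>))\<^sup>2"
      by (intro power_strict_mono) auto
    thus ?thesis
      using \<epsilon> \<sigma>_le[OF that(1)] by simp
  qed
  have Q_nonneg: "0 \<le> Q y (a * (y $ j) + v)" if "norm y \<le> \<epsilon>" "v \<in> T" for y v
    unfolding Q_def using small[OF that] \<sigma>_le[OF that(1)] by (auto intro!: power_mono)
  have P_eq: "P v = (LINT y:cball 0 \<epsilon>|lborel. Q y (a * (y $ j) + v))" for v
    unfolding P_def Q_def ..
  show "v \<in> T \<Longrightarrow> 0 \<le> P v"
    unfolding P_eq set_lebesgue_integral_def
    by (intro integral_nonneg_AE) (auto simp: indicator_def Q_nonneg)

  have slice: "emeasure lborel ((\<lambda>x. (x, y)) -` ?S)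
      = (\<integral>\<^sup>+v. ennreal (unit_ball_vol (2 * k) * Q y (a * (y $ j) + v)) * indicator T v
        * indicator (cball 0 \<epsilon>) y \<partial>lborel)" for y
  proof (cases "norm y \<le> \<epsilon>")
    case True
    let ?T = "{u. u - a * (y $ j) \<in> T}"
    have \<sigma>_iff: "z\<^sup>2 + (norm y)\<^sup>2 \<le> \<epsilon>\<^sup>2 \<longleftrightarrow> \<bar>z\<bar> \<le> \<sigma> y" for z
      using real_sqrt_le_iff[of "z\<^sup>2" "\<epsilon>\<^sup>2 - (norm y)\<^sup>2"] by (auto simp: \<sigma>_def)
    have "(\<lambda>x. (x, y)) -` ?S
        = {x. ((norm x)\<^sup>2 - 1)\<^sup>2 + (norm y)\<^sup>2 \<le> \<epsilon>\<^sup>2 \<and> x $ i - a * (y $ j) \<in> T}"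
      by (auto simp: W_body_eq)
    also have "\<dots> = {x. x \<bullet> axis i 1 \<in> ?T \<and> 1 - \<sigma> y \<le> (norm x)\<^sup>2 \<and> (norm x)\<^sup>2 \<le> 1 + \<sigma> y}"
      unfolding \<sigma>_iff abs_le_iff by (auto simp: inner_axis)
    also have "emeasure lborel \<dots> = (\<integral>\<^sup>+u. ennreal (unit_ball_vol (2 * k) * Q y u) * indicator ?T u \<partial>lborel)"
      unfolding Q_def
    proof (rule emeasure_shell_slab)
      show "u\<^sup>2 < 1 - \<sigma> y" if "u \<in> ?T" for u
        using small[OF True, of "u - a * (y $ j)"] that by simp
    qed (use k \<sigma>_le[OF True] in \<open>auto simp: axis_in_Basis_iff\<close>)
    \<comment> \<open>The translation \<open>u = a * (y $ j) + v\<close> makes the domain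
      \<open>T\<close> independent of \<open>y\<close>, which prepares the exchange of the
      integrals.\<close>
    also have "\<dots> = (\<integral>\<^sup>+v. ennreal (unit_ball_vol (2 * k) * Q y (a * (y $ j) + v)) * indicator T v \<partial>lborel)"
      unfolding Q_def
      by (subst nn_integral_real_affine[where c = 1 and t = "a * (y $ j)"]) (auto simp: indicator_def)
    finally show ?thesis
      using True by simp
  next
    case False
    hence "(norm y)\<^sup>2 > \<epsilon>\<^sup>2"
      using \<epsilon> by (intro power_strict_mono) auto
    hence "\<not> z\<^sup>2 + (norm y)\<^sup>2 \<le> \<epsilon>\<^sup>2" for z
      using zero_le_power2[of z] by linarith
    hence "(\<lambda>x. (x, y)) -` ?S = {}"
      by (auto simp: W_body_eq)
    thus ?thesis
      using False by simp
  qed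
  have "emeasure lborel ?S = emeasure (lborel \<Otimes>\<^sub>M lborel) ?S"
    by (simp add: lborel_prod)
  also have "\<dots> = (\<integral>\<^sup>+y. emeasure lborel ((\<lambda>x. (x, y)) -` ?S) \<partial>lborel)"
    using S by (intro lborel_pair.emeasure_pair_measure_alt2) (simp only: lborel_prod sets_lborel)
  also have "\<dots> = (\<integral>\<^sup>+v. \<integral>\<^sup>+y. ennreal (unit_ball_vol (2 * k) * Q y (a * (y $ j) + v)) * indicator T v
      * indicator (cball 0 \<epsilon>) y \<partial>lborel \<partial>lborel)"
    unfolding slice Q_def by (rule lborel_pair.Fubini') measurable
  also have "\<dots> = (\<integral>\<^sup>+v. ennreal (unit_ball_vol (2 * k) * P v) * indicator T v \<partial>lborel)"
  proof (rule nn_integral_cong)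
    fix v :: real
    show "(\<integral>\<^sup>+y. ennreal (unit_ball_vol (2 * k) * Q y (a * (y $ j) + v)) * indicator T v
        * indicator (cball 0 \<epsilon>) y \<partial>lborel) = ennreal (unit_ball_vol (2 * k) * P v) * indicator T v"
    proof (cases "v \<in> T")
      case True
      \<comment> \<open>For \<open>v\<close> in \<open>T\<close> the integrand is continuous and
        nonnegative on a compact ball, so the extended integral agrees with the real one defining
        \<open>P\<close>.\<close>
      have "set_integrable lborel (cball 0 \<epsilon>) (\<lambda>y. unit_ball_vol (2 * k) * Q y (a * (y $ j) + v))"
        unfolding Q_def by (intro set_integrable_compact compact_cball continuous_intros \<sigma>_cont)
      hence "(\<integral>\<^sup>+y. ennreal (indicator (cball 0 \<epsilon>) y *\<^sub>R (unit_ball_vol (2 * k) * Q y (a * (y $ j) + v))) \<partial>lborel)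
          = ennreal (LINT y:cball 0 \<epsilon>|lborel. unit_ball_vol (2 * k) * Q y (a * (y $ j) + v))"
        unfolding set_lebesgue_integral_def set_integrable_def
        by (intro nn_integral_eq_integral) (auto simp: indicator_def True Q_nonneg)
      thus ?thesis
        using True by (simp add: P_eq indicator_mult_ennreal mult_ac)
    qed simp
  qed
  finally show "emeasure lborel ?S = (\<integral>\<^sup>+v. ennreal (unit_ball_vol (2 * k) * P v) * indicator T v \<partial>lborel)" .
qed

text \<open>Moving the hyperplane from \<open>0\<close> to \<open>t\<close> adds the slab over
  \<open>{0<..t}\<close>, which is disjoint from the part at \<open>0\<close>. Writing the gain as
  the integral of a continuous \<open>P\<close> prepares the fundamental theorem of
  calculus.\<close>

lemma measure_lower_part:
  fixes i :: "'n::finite" and j :: "'m::finite"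
  assumes k: "CARD('n) = 2 * k + 1" and \<epsilon>: "0 < \<epsilon>" "\<epsilon> < 1"
    and t: "0 \<le> t" "t \<le> sqrt (1 - \<epsilon>) / 2"
    and a: "\<bar>a\<bar> \<le> sqrt (1 - \<epsilon>) / 2"
  defines "\<sigma> \<equiv> \<lambda>y :: real ^ 'm. sqrt (\<epsilon>\<^sup>2 - (norm y)\<^sup>2)"
  assumes P: "continuous_on {0..t} P" "\<And>v. P v = unit_ball_vol (2 * k) * (LINT y:cball 0 \<epsilon>|lborel.
    (1 + \<sigma> y - (a * (y $ j) + v)\<^sup>2) ^ k - (1 - \<sigma> y - (a * (y $ j) + v)\<^sup>2) ^ k)"
  shows "measure lborel (lower_part i j \<epsilon> a t) = measure lborel (lower_part i j \<epsilon> a 0) + integral {0..t} P"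
proof -
  let ?S = "W_body \<epsilon> \<inter> {(x :: real ^ 'n, y :: real ^ 'm). x $ i - a * (y $ j) \<in> {0<..t}}"
  have fin: "A \<in> fmeasurable lborel" if "A \<in> sets borel" "A \<subseteq> W_body \<epsilon>" for A :: "((real ^ 'n) \<times> (real ^ 'm)) set"
    using that emeasure_bounded_finite[OF bounded_subset[OF bounded_W_body]] by (auto simp: fmeasurable_def)
  have nonneg: "0 \<le> P v" if "v \<in> {0..t}" for v
    unfolding P(2) \<sigma>_def
    by (intro mult_nonneg_nonneg emeasure_W_body_slab(2)[OF k \<epsilon> _ _ a, of "{0..t}"])
       (use t that in auto)
  have "emeasure lborel ?S = (\<integral>\<^sup>+v. ennreal (P v) * indicator {0<..t} v \<partial>lborel)"
    unfolding P(2) \<sigma>_def by (rule emeasure_W_body_slab(1)[OF k \<epsilon> _ _ a]) (use t in auto)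
  \<comment> \<open>The half-open interval gives disjointness, the integral to be differentiated
    uses the closed one; they differ by the null set \<open>{0}\<close>.\<close>
  also have "\<dots> = (\<integral>\<^sup>+v. ennreal (P v) * indicator {0..t} v \<partial>lborel)"
    using AE_lborel_singleton[of "0 :: real"] by (intro nn_integral_cong_AE) (auto simp: indicator_def)
  also have "\<dots> = ennreal (integral {0..t} P)"
    using nonneg P(1) by (intro nn_integral_has_integral_lebesgue') (auto intro: integrable_continuous_real)
  finally have "measure lborel ?S = integral {0..t} P"
    using nonneg Henstock_Kurzweil_Integration.integral_nonneg[OF integrable_continuous_real[OF P(1)]]
    by (simp add: measure_def)
  moreover have "measure lborel (lower_part i j \<epsilon> a 0 \<union> ?S) = measure lborel (lower_part i j \<epsilon> a 0) + measure lborel ?S"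
  proof (rule measure_Un_AE)
    show "lower_part i j \<epsilon> a 0 \<in> fmeasurable lborel" "?S \<in> fmeasurable lborel"
      unfolding lower_part_eq by (intro fin W_body_Int_sets; auto)+
  qed (auto simp: lower_part_eq)
  moreover have "lower_part i j \<epsilon> a t = lower_part i j \<epsilon> a 0 \<union> ?S"
    using t by (auto simp: lower_part_eq)
  ultimately show ?thesis
    by simp
qed

section \<open>The polynomial, its exact degree and the derivative\<close>

theorem mainTheorem1:
  fixes k :: nat and i :: "'n::finite" and j :: "'m::finite" and \<epsilon> :: real
  assumes "k \<ge> 1"
    and "CARD('n) = 2 * k + 1"
    and "0 < \<epsilon>" and "\<epsilon> < 1"
  shows "\<exists>\<delta>>0. \<exists>p. bivariate_polynomial_of_degree (k - 1) p \<and>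
    (\<forall>a b. 0 \<le> a \<and> a < \<delta> \<and> 0 \<le> b \<and> b < \<delta> \<longrightarrow>
      ((\<lambda>t. larger_volume i j \<epsilon> a t) has_real_derivative p (a\<^sup>2) (b\<^sup>2)) (at b within {0..}))"
proof -
  \<comment> \<open>The same bound for \<open>a\<close> and \<open>b\<close> keeps
    \<open>\<bar>a * (y $ j) + b\<bar>\<close> below \<open>sqrt (1 - \<epsilon>)\<close> for all
    \<open>y\<close> in the ball.\<close>
  define \<delta> where "\<delta> = sqrt (1 - \<epsilon>) / 2"
  define \<sigma> where "\<sigma> y = sqrt (\<epsilon>\<^sup>2 - (norm y)\<^sup>2)" for y :: "real ^ 'm"
  define c where "c r q = unit_ball_vol (2 * k) * (real (2 * (r + q) choose (2 * r))
    * (LINT y:cball 0 \<epsilon>|lborel. (y $ j) ^ (2 * r) * shell_coeff k (r + q) (\<sigma> y)))" for r q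
  define p where "p u v = (\<Sum>(r, q)\<in>{(r, q). r + q \<le> k - 1}. c r q * u ^ r * v ^ q)" for u v
  have "\<delta> > 0"
    using assms by (simp add: \<delta>_def)
  have \<sigma>_cont: "continuous_on UNIV \<sigma>"
    unfolding \<sigma>_def by (intro continuous_intros)
  have p_eq: "p (a\<^sup>2) (v\<^sup>2) = unit_ball_vol (2 * k) * (LINT y:cball 0 \<epsilon>|lborel.
      (1 + \<sigma> y - (a * (y $ j) + v)\<^sup>2) ^ k - (1 - \<sigma> y - (a * (y $ j) + v)\<^sup>2) ^ k)" for a v
    using integral_shell_polynomial[OF assms(1) \<sigma>_cont, where b = "axis j 1" and \<epsilon> = \<epsilon> and a = a and v = v]
    by (simp add: \<sigma>_def p_def c_def inner_axis sum_distrib_left case_prod_unfold mult_ac)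
  \<comment> \<open>For \<open>e = k - 1\<close> the bracket is
    \<open>(1 + s) - (1 - s) = 2 * s\<close>. Hence the coefficient at \<open>r = 0\<close>,
    \<open>q = k - 1\<close> is a nonzero multiple of the positive integral of
    \<open>\<sigma>\<close>, and the degree is exactly \<open>k - 1\<close>.\<close>
  have "shell_coeff k (k - 1) s = 2 * (- 1) ^ (k - 1) * real k * s" for s
    using assms(1) by (cases k) (simp_all add: shell_coeff_def algebra_simps)
  hence "c 0 (k - 1) = unit_ball_vol (2 * k) * (2 * (- 1) ^ (k - 1) * real k)
      * (LINT y:cball 0 \<epsilon>|lborel. \<sigma> y)"
    by (simp add: c_def)
  moreover have "(LINT y:cball 0 \<epsilon>|lborel. \<sigma> y) > 0"
    unfolding \<sigma>_def by (rule integral_cball_sqrt_pos) fact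
  moreover have "unit_ball_vol (2 * k) \<noteq> 0"
    using unit_ball_vol_pos[of "2 * k"] by (simp del: unit_ball_vol_pos)
  ultimately have "c 0 (k - 1) \<noteq> 0"
    using assms(1) by simp
  hence "bivariate_polynomial_of_degree (k - 1) p"
    unfolding bivariate_polynomial_of_degree_def p_def by (metis add_0)
  moreover have "((\<lambda>t. larger_volume i j \<epsilon> a t) has_real_derivative p (a\<^sup>2) (b\<^sup>2)) (at b within {0..})"
    if a: "0 \<le> a" "a < \<delta>" and b: "0 \<le> b" "b < \<delta>" for a b
  proof -
    define P where "P v = p (a\<^sup>2) (v\<^sup>2)" for v
    have P_cont: "continuous_on S P" for S
      unfolding P_def p_def case_prod_unfold by (intro continuous_intros)
    have vol: "larger_volume i j \<epsilon> a t = measure lborel (lower_part i j \<epsilon> a 0) + integral {0..t} P"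
      if "t \<in> {0..\<delta>}" for t
      unfolding larger_volume_eq_lower[of t, OF that[simplified, THEN conjunct1]]
      by (rule measure_lower_part[OF assms(2-4)]) (use a that P_cont in \<open>auto simp: \<delta>_def P_def p_eq \<sigma>_def\<close>)
    have "((\<lambda>t. measure lborel (lower_part i j \<epsilon> a 0) + integral {0..t} P) has_real_derivative P b) (at b within {0..\<delta>})"
      using integral_has_real_derivative[OF P_cont, of b 0 \<delta>] b by (auto intro!: derivative_eq_intros)
    \<comment> \<open>The two functions agree on all of \<open>{0..\<delta>}\<close>, so any
      positive radius, here 1, will do.\<close>
    hence "((\<lambda>t. larger_volume i j \<epsilon> a t) has_real_derivative P b) (at b within {0..\<delta>})"
      by (rule has_field_derivative_transform_within[OF _ zero_less_one]) (use b vol in auto)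
    \<comment> \<open>Since \<open>b < \<delta>\<close>, both sets coincide near \<open>b\<close>;
      at \<open>b = 0\<close> both give the one-sided derivative.\<close>
    moreover have "at b within {0..\<delta>} = at b within {0..}"
      by (rule at_within_nhd[of b "{..<\<delta>}"]) (use b in auto)
    ultimately show ?thesis
      by (simp add: P_def)
  qed
  ultimately show ?thesis
    using \<open>\<delta> > 0\<close> by blast
qed

end
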